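(* For all nonnegative integers $b,c$, the quantity $A(b,c)$ is defined (i.e. there exists a nonnegative integer $a$ with $\mathcal{N}(a,b,c)=a+b+c$), and $A(b,c)\le \min(\sim b,\sim c)+1$.
   Context: For nonnegative integers $a,b,c$, the position $(a,b,c)$, i.e. the selective compound of the Nim heap $*a$ with the disjunctive sum of the Nim heaps $*b$ and $*c$, is the impartial game (normal play) in which a move consists of one of the following: strictly decrease $a$ only; strictly decrease exactly one of $b,c$ only; or do both simultaneously (strictly decrease $a$ and strictly decrease exactly one of $b,c$). All heap sizes stay nonnegative integers. $\mathcal{N}(a,b,c)$ denotes the Sprague-Grundy value: $0$ at terminal positions, and otherwise the minimum nonnegative integer not occurring among the Sprague-Grundy values of the positions reachable in one move. $A(b,c)$ is defined as the minimum nonnegative integer $a$ such that $\mathcal{N}(a,b,c)=a+b+c$. For $x\ge 1$, $\sim x$ denotes the bitwise complement of $x$ with respect to its own binary length, i.e. $\sim x=2^{\lfloor\log_2 x\rfloor+1}-1-x$; by convention $\sim 0=0$. *)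

theory Defs
  imports Complex_Main
begin

type_synonym position = "nat \<times> nat \<times> nat"

text \<open>The position \<open>(a, b, c)\<close> is the selective compound of the Nim heap \<open>a\<close> with the disjunctive
  sum of the Nim heaps \<open>b\<close> and \<open>c\<close>: one moves in the first component, in the second, or in both
  at once.\<close>

inductive move :: "position \<Rightarrow> position \<Rightarrow> bool" where
  first: "a' < a \<Longrightarrow> move (a, b, c) (a', b, c)"
| second_left: "b' < b \<Longrightarrow> move (a, b, c) (a, b', c)"
| second_right: "c' < c \<Longrightarrow> move (a, b, c) (a, b, c')"
| both_left: "a' < a \<Longrightarrow> b' < b \<Longrightarrow> move (a, b, c) (a', b', c)"
| both_right: "a' < a \<Longrightarrow> c' < c \<Longrightarrow> move (a, b, c) (a', b, c')"

definition options :: "position \<Rightarrow> position set" where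
  "options p = {q. move p q}"

definition mex :: "nat set \<Rightarrow> nat" where
  "mex S = (LEAST n. n \<notin> S)"

text \<open>At a terminal position the set of options is empty, so the value is \<open>mex {} = 0\<close>.\<close>

function sg :: "position \<Rightarrow> nat" where
  "sg p = mex (sg ` options p)"
  by auto
termination
  by (relation "measure (\<lambda>(a, b, c). a + b + c)") (auto simp: options_def elim: move.cases)

declare sg.simps [simp del]

abbreviation SG :: "nat \<Rightarrow> nat \<Rightarrow> nat \<Rightarrow> nat" where
  "SG a b c \<equiv> sg (a, b, c)"

text \<open>Meaningful only if some \<open>a\<close> satisfies the equation.\<close>

definition A :: "nat \<Rightarrow> nat \<Rightarrow> nat" where
  "A b c = (LEAST a. SG a b c = a + b + c)"

text \<open>Bitwise complement within the binary length of the argument. The natural-number subtractions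
  do not truncate, since \<open>x < 2 ^ (\<lfloor>log 2 x\<rfloor> + 1)\<close> for \<open>x \<ge> 1\<close>.\<close>

definition bitcompl :: "nat \<Rightarrow> nat" where
  "bitcompl x = (if x = 0 then 0 else 2 ^ (nat \<lfloor>log 2 (real x)\<rfloor> + 1) - 1 - x)"

end

theory Submission
  imports Defs
begin

text \<open>
  Write \<open>x \<oplus> y\<close> for the nim-sum of \<open>x\<close> and \<open>y\<close>. Each move lowers \<open>a + b + c\<close>, so
  \<open>SG a b c \<le> a + b + c\<close>, and the question is when equality holds. The number
  \<open>a = bitcompl b + 1\<close> equals \<open>2 ^ k - b\<close>, where \<open>k\<close> is the binary length of \<open>b\<close>. For this \<open>a\<close>
  equality holds whatever \<open>c\<close> is (\<open>sg_eq_total\<close>). Exchanging \<open>b\<close> and \<open>c\<close> does not change the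
  game, so \<open>a = bitcompl c + 1\<close> works as well, and both numbers bound the least solution \<open>A b c\<close>.

  To see that \<open>(2 ^ k - b, b, c)\<close> has value \<open>2 ^ k + c\<close>, one has to find every smaller number among
  the values of its options. By induction on \<open>c\<close>, lowering \<open>c\<close> alone gives the numbers from
  \<open>2 ^ k\<close> to \<open>2 ^ k + c - 1\<close>. The numbers below \<open>2 ^ k\<close> need a counting argument
  (\<open>sg_ge_power\<close>). Emptying the heap \<open>a\<close> leaves ordinary Nim, so a player can reach the values
  \<open>b' \<oplus> c\<close> with \<open>b' \<le> b\<close> and \<open>b \<oplus> c'\<close> with \<open>c' \<le> c\<close>. If \<open>c \<ge> 2 ^ k\<close>, the latter already
  cover everything below \<open>2 ^ k\<close>. If \<open>c < 2 ^ k\<close>, then \<open>v \<mapsto> v \<oplus> c\<close> permutes the numbers below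
  \<open>2 ^ k\<close>, so the values \<open>b' \<oplus> c\<close> miss only \<open>2 ^ k - 1 - b = a - 1\<close> of these numbers. The \<open>a\<close>
  positions \<open>(i, b, c)\<close> with \<open>1 \<le> i \<le> a\<close> have distinct values, increasing in \<open>i\<close>, and none of
  them is a value \<open>b' \<oplus> c\<close>, since each of these positions also has the moves to \<open>(0, b', c)\<close>.
  So they cannot all be among the missed numbers, and the largest value, that of
  \<open>(a, b, c)\<close>, is at least \<open>2 ^ k\<close>.
\<close>

lemma options_eq:
  "options (a, b, c) =
     {(a', b, c) | a'. a' < a} \<union> {(a', b', c) | a' b'. a' \<le> a \<and> b' < b} \<union>
     {(a', b, c') | a' c'. a' \<le> a \<and> c' < c}"
  unfolding options_def
  by (auto elim!: move.cases intro: move.intros simp: le_less)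

lemma finite_option_set: "finite (options p)"
proof -
  obtain a b c where p: "p = (a, b, c)" by (cases p)
  have "options p \<subseteq> {..a} \<times> {..b} \<times> {..c}"
    unfolding p options_eq by auto
  then show ?thesis by (rule finite_subset) auto
qed

lemma mex_notin: "finite S \<Longrightarrow> mex S \<notin> S"
  unfolding mex_def by (metis LeastI ex_new_if_finite infinite_UNIV_nat)

lemma sg_notin: "sg p \<notin> sg ` options p"
  using mex_notin[of "sg ` options p"] finite_option_set by (simp add: sg.simps[of p])

lemma less_sg_imp_in: "v < sg p \<Longrightarrow> v \<in> sg ` options p"
  using not_less_Least[of v "\<lambda>n. n \<notin> sg ` options p"] by (simp add: sg.simps[of p] mex_def)

lemma sg_eqI:
  assumes "n \<notin> sg ` options p" "\<And>v. v < n \<Longrightarrow> v \<in> sg ` options p"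
  shows "sg p = n"
  using assms less_sg_imp_in sg_notin by (metis nat_neq_iff)

lemma sg_geI:
  assumes "\<And>v. v < n \<Longrightarrow> v \<in> sg ` options p"
  shows "n \<le> sg p"
  using assms sg_notin by (meson not_le)

lemma sg_mono: "options p \<subseteq> options q \<Longrightarrow> sg p \<le> sg q"
  by (rule sg_geI) (use less_sg_imp_in in blast)

lemma sg_le_total: "SG a b c \<le> a + b + c"
proof (induction "a + b + c" arbitrary: a b c rule: less_induct)
  case less
  have "sg q < a + b + c" if "q \<in> options (a, b, c)" for q
  proof -
    obtain x y z where q: "q = (x, y, z)" by (cases q)
    have "x + y + z < a + b + c" using that unfolding q options_eq by auto
    with less[of x y z] show ?thesis unfolding q by linarith
  qed
  then have "a + b + c \<notin> sg ` options (a, b, c)" by fastforce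
  then show ?case using less_sg_imp_in by (meson not_le)
qed

lemma sg_swap: "SG a b c = SG a c b"
proof (induction "a + b + c" arbitrary: a b c rule: less_induct)
  case less
  have *: "sg ` options (a, b, c) \<subseteq> sg ` options (a, c, b)"
    if IH: "\<And>x y z. x + y + z < a + b + c \<Longrightarrow> SG x y z = SG x z y" for a b c
  proof (rule image_subsetI)
    fix q assume q: "q \<in> options (a, b, c)"
    obtain x y z where xyz: "q = (x, y, z)" by (cases q)
    have "x + y + z < a + b + c" "(x, z, y) \<in> options (a, c, b)"
      using q unfolding xyz options_eq by auto
    then show "sg q \<in> sg ` options (a, c, b)" unfolding xyz using IH by blast
  qed
  have "sg ` options (a, b, c) = sg ` options (a, c, b)"
  proof (rule subset_antisym)
    show "sg ` options (a, b, c) \<subseteq> sg ` options (a, c, b)"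
      by (rule *) (rule less)
    show "sg ` options (a, c, b) \<subseteq> sg ` options (a, b, c)"
      by (rule *) (rule less, simp)
  qed
  then show ?case by (simp add: sg.simps[of "(a, b, c)"] sg.simps[of "(a, c, b)"])
qed

unbundle bit_operations_syntax

lemma xor_cancel_nat: "((x :: nat) XOR y) XOR y = x"
  by (simp add: xor.assoc)

text \<open>This is the winning strategy of Nim. At the highest bit where \<open>v\<close> and \<open>x \<oplus> y\<close>
  differ, \<open>v\<close> has \<open>0\<close> and exactly one of \<open>x\<close> and \<open>y\<close> has \<open>1\<close>. That heap can be lowered so
  that the nim-sum becomes \<open>v\<close>. The induction halves all numbers until the differing bit is the
  last one.\<close>

lemma less_xor_cases:
  fixes v x y :: nat
  assumes "v < x XOR y"
  shows "v XOR y < x \<or> v XOR x < y"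
  using assms
proof (induction v arbitrary: x y rule: less_induct)
  case (less v)
  have rec: "m XOR n = of_bool (odd m \<noteq> odd n) + 2 * ((m div 2) XOR (n div 2))" for m n :: nat
    by (rule xor_rec)
  have half: "m < n" if "m div 2 < n div 2" for m n :: nat
    using that by (meson div_le_mono leD leI)
  have div2: "(m XOR n) div 2 = (m div 2) XOR (n div 2)" for m n :: nat
    by (subst rec) auto
  consider "v div 2 < (x div 2) XOR (y div 2)" | "v div 2 = (x div 2) XOR (y div 2)"
    using less.prems div2[of x y] by (metis div_le_mono le_neq_implies_less less_imp_le)
  then show ?case
  proof cases
    case 1
    show ?thesis
    proof (cases "v = 0")
      case True
      then show ?thesis using less.prems by (cases "x = y") auto
    next
      case False
      then have "v div 2 < v" by simp
      from less.IH[OF this 1] show ?thesis by (metis div2 half)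
    qed
  next
    case 2
    \<comment> \<open>Only the last bits differ: \<open>v\<close> is even and exactly one of \<open>x\<close>, \<open>y\<close> is odd.\<close>
    have parity: "even v" "odd x \<noteq> odd y"
    proof -
      have "v < of_bool (odd x \<noteq> odd y) + 2 * (v div 2)"
        using less.prems rec[of x y] 2 by simp
      then show "even v" "odd x \<noteq> odd y"
        by (simp_all split: if_splits add: of_bool_def) presburger+
    qed
    have "(v div 2) XOR (y div 2) = x div 2" "(v div 2) XOR (x div 2) = y div 2"
      unfolding 2 by (metis xor_cancel_nat xor.commute)+
    then have "v XOR y = of_bool (odd y) + 2 * (x div 2)" "v XOR x = of_bool (odd x) + 2 * (y div 2)"
      using rec[of v y] rec[of v x] parity by auto
    then show ?thesis using parity by (cases "odd x") (auto elim!: oddE)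
  qed
qed

lemma sg_zero_eq_xor: "SG 0 b c = b XOR c"
proof (induction "b + c" arbitrary: b c rule: less_induct)
  case less
  have opts: "options (0, b, c) = (\<lambda>b'. (0, b', c)) ` {..<b} \<union> (\<lambda>c'. (0, b, c')) ` {..<c}"
    unfolding options_eq by auto
  have "sg ` options (0, b, c) = (\<lambda>b'. b' XOR c) ` {..<b} \<union> (\<lambda>c'. b XOR c') ` {..<c}"
    unfolding opts image_Un image_image using less
    by (intro arg_cong2[of _ _ _ _ "(\<union>)"] image_cong) auto
  moreover have "b XOR c \<notin> (\<lambda>b'. b' XOR c) ` {..<b} \<union> (\<lambda>c'. b XOR c') ` {..<c}"
    by (auto; metis xor_cancel_nat xor.commute less_irrefl)
  moreover have "v \<in> (\<lambda>b'. b' XOR c) ` {..<b} \<union> (\<lambda>c'. b XOR c') ` {..<c}" if "v < b XOR c" for v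
    using less_xor_cases[OF that]
  proof
    assume "v XOR c < b"
    then show ?thesis by (intro UnI1 image_eqI[of _ _ "v XOR c"]) (auto simp: xor_cancel_nat)
  next
    assume "v XOR b < c"
    then show ?thesis
      by (intro UnI2 image_eqI[of _ _ "v XOR b"]) (auto simp: xor_cancel_nat xor.commute[of b])
  qed
  ultimately show ?case by (intro sg_eqI) simp_all
qed

lemma xor_less_power:
  fixes x y :: nat
  assumes "x < 2 ^ k" "y < 2 ^ k"
  shows "x XOR y < 2 ^ k"
  using assms by (metis take_bit_nat_eq_self_iff take_bit_xor)

lemma sg_ge_power:
  assumes b: "b < 2 ^ k"
  shows "2 ^ k \<le> SG (2 ^ k - b) b c"
proof (rule ccontr)
  define a where "a = 2 ^ k - b"
  assume "\<not> 2 ^ k \<le> SG (2 ^ k - b) b c"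
  then have small: "SG a b c < 2 ^ k" by (simp add: a_def)
  have a: "a > 0" using b by (simp add: a_def)
  have xor_notin: "SG i b c \<noteq> b' XOR c" if "0 < i" "b' \<le> b" for i b'
  proof -
    have "(0, b', c) \<in> options (i, b, c)" using that unfolding options_eq by auto
    then show ?thesis using sg_notin[of "(i, b, c)"] sg_zero_eq_xor[of b' c] by (metis image_eqI)
  qed
  show False
  proof (cases "c < 2 ^ k")
    case True
    define s where "s i = SG i b c XOR c" for i
    have range: "s ` {1..a} \<subseteq> {b<..<2 ^ k}"
    proof (rule image_subsetI)
      fix i assume i: "i \<in> {1..a}"
      have "options (i, b, c) \<subseteq> options (a, b, c)" using i unfolding options_eq by auto
      then have "SG i b c < 2 ^ k" using small sg_mono le_less_trans by blast
      moreover have "\<not> s i \<le> b"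
        using xor_notin[of i "s i"] i by (auto simp: s_def xor_cancel_nat)
      ultimately show "s i \<in> {b<..<2 ^ k}" using True by (simp add: s_def xor_less_power)
    qed
    have distinct_values: "SG i b c \<noteq> SG j b c" if "i < j" for i j
    proof -
      have "(i, b, c) \<in> options (j, b, c)" using that unfolding options_eq by auto
      then show ?thesis using sg_notin[of "(j, b, c)"] by (metis image_eqI)
    qed
    have "inj_on s {1..a}"
      by (rule inj_onI) (metis s_def xor_cancel_nat distinct_values nat_neq_iff)
    \<comment> \<open>The interval has \<open>2 ^ k - b - 1\<close> elements, one fewer than there are indices.\<close>
    then have "card {1..a} \<le> card {b<..<2 ^ k}" by (rule card_inj_on_le) (use range in auto)
    then show False using a by (simp add: a_def)
  next
    case False
    define c' where "c' = SG a b c XOR b"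
    have "c' < c" using xor_less_power[OF small b] False by (simp add: c'_def)
    then have "(0, b, c') \<in> options (a, b, c)" unfolding options_eq by auto
    moreover have "sg (0, b, c') = SG a b c"
      by (simp add: sg_zero_eq_xor c'_def xor.commute[of b] xor_cancel_nat)
    ultimately show False using sg_notin[of "(a, b, c)"] by (metis image_eqI)
  qed
qed

lemma sg_eq_total:
  assumes b: "b < 2 ^ k"
  shows "SG (2 ^ k - b) b c = (2 ^ k - b) + b + c"
proof (induction c rule: less_induct)
  case (less c)
  let ?p = "(2 ^ k - b, b, c)"
  have "2 ^ k + c \<le> sg ?p"
  proof (rule sg_geI)
    fix v assume v: "v < 2 ^ k + c"
    show "v \<in> sg ` options ?p"
    proof (cases "v < 2 ^ k")
      case True
      then show ?thesis using sg_ge_power[OF b, of c] less_sg_imp_in by (meson less_le_trans)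
    next
      case False
      define c' where "c' = v - 2 ^ k"
      have c': "c' < c" "v = 2 ^ k + c'" using v False by (auto simp: c'_def)
      have "(2 ^ k - b, b, c') \<in> options ?p" using c' unfolding options_eq by auto
      moreover have "SG (2 ^ k - b) b c' = v" using less[OF c'(1)] b c' by simp
      ultimately show ?thesis by (metis image_eqI)
    qed
  qed
  then show ?case using sg_le_total[of "2 ^ k - b" b c] b by simp
qed

lemma bitcompl_Suc_eq: "\<exists>k. b < 2 ^ k \<and> bitcompl b + 1 = 2 ^ k - b"
proof (cases "b = 0")
  case True
  \<comment> \<open>The convention for \<open>0\<close> is the formula with binary length \<open>0\<close>.\<close>
  then show ?thesis by (intro exI[of _ 0]) (simp add: bitcompl_def)
next
  case False
  define k where "k = nat \<lfloor>log 2 (real b)\<rfloor> + 1"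
  have "log 2 (real b) < real k" unfolding k_def by linarith
  then have "real b < 2 powr real k" using False by (simp add: log_less_iff)
  then have less: "b < 2 ^ k" by (simp add: powr_realpow)
  then have "bitcompl b + 1 = 2 ^ k - b" using False by (simp add: bitcompl_def k_def)
  with less show ?thesis by blast
qed

theorem lemma7:
  fixes b c :: nat
  shows "(\<exists>a. SG a b c = a + b + c) \<and> A b c \<le> min (bitcompl b) (bitcompl c) + 1"
proof -
  have eq: "SG (bitcompl x + 1) x y = (bitcompl x + 1) + x + y" for x y
    using bitcompl_Suc_eq[of x] sg_eq_total by metis
  have left: "SG (bitcompl b + 1) b c = (bitcompl b + 1) + b + c" by (rule eq)
  have right: "SG (bitcompl c + 1) b c = (bitcompl c + 1) + b + c"
    using eq[of c b] sg_swap[of "bitcompl c + 1" b c] by simp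
  have "A b c \<le> bitcompl b + 1" "A b c \<le> bitcompl c + 1"
    unfolding A_def using left right by (auto intro: Least_le)
  then have "A b c \<le> min (bitcompl b) (bitcompl c) + 1" by simp
  with left show ?thesis by blast
qed

end
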